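(* For almost every graph on $\mathbb{N}$, every set $A \subseteq \mathbb{N}$ with $\sum_{n \in A}\frac{1}{n} = \infty$ is weakly universal.
   Context: $\mathbb{N}=\{1,2,3,\dots\}$. All graphs are simple and undirected. A random graph on $\mathbb{N}$ is formed by including each pair $\{m,n\}$ ($m\neq n$) as an edge independently with probability $\tfrac12$; "almost every graph on $\mathbb{N}$ has property $P$" means that this random graph has property $P$ with probability $1$. For a fixed graph on $\mathbb{N}$, a set $A\subseteq\mathbb{N}$ is weakly universal if the induced subgraph on $A$ contains every finite graph as an induced subgraph. *)

theory Defs
  imports "HOL-Probability.Probability" "HOL-Library.Ramsey"
begin

type_synonym 'a graph = "'a set \<times> 'a set set"

abbreviation verts :: "'a graph \<Rightarrow> 'a set" where "verts \<equiv> fst"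
abbreviation edges :: "'a graph \<Rightarrow> 'a set set" where "edges \<equiv> snd"

text \<open>The \<^const>\<open>nsets\<close> notation below denotes the set of all two-element subsets.\<close>

definition simple_graph :: "'a graph \<Rightarrow> bool" where
  "simple_graph G \<longleftrightarrow> edges G \<subseteq> [verts G]\<^bsup>2\<^esup>"

definition finite_graph :: "'a graph \<Rightarrow> bool" where
  "finite_graph G \<longleftrightarrow> simple_graph G \<and> finite (verts G)"

definition induced_subgraph :: "'a graph \<Rightarrow> 'a set \<Rightarrow> 'a graph" where
  "induced_subgraph G A = (A, {e \<in> edges G. e \<subseteq> A})"

definition graph_isomorphic :: "'a graph \<Rightarrow> 'b graph \<Rightarrow> bool" where
  "graph_isomorphic G H \<longleftrightarrow>
     (\<exists>f. bij_betw f (verts G) (verts H) \<and>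
          (\<forall>u\<in>verts G. \<forall>v\<in>verts G. {u, v} \<in> edges G \<longleftrightarrow> {f u, f v} \<in> edges H))"

definition contains_induced :: "'a graph \<Rightarrow> 'b graph \<Rightarrow> bool" where
  "contains_induced G H \<longleftrightarrow>
     (\<exists>S\<subseteq>verts G. graph_isomorphic (induced_subgraph G S) H)"

text \<open>Every finite graph has an isomorphic copy with vertices in \<^typ>\<open>nat\<close>, so quantifying over
  those graphs loses nothing; see \<open>weakly_universal_any_type\<close> below.\<close>

definition weakly_universal :: "'a graph \<Rightarrow> 'a set \<Rightarrow> bool" where
  "weakly_universal G A \<longleftrightarrow>
     (\<forall>H :: nat graph. finite_graph H \<longrightarrow> contains_induced (induced_subgraph G A) H)"

text \<open>The vertex set excludes 0. The sample space consists of one independent fair coin for each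
  unordered pair of distinct vertices.\<close>

abbreviation pos_nats :: "nat set" where "pos_nats \<equiv> {1..}"

definition coin_space :: "(nat set \<Rightarrow> bool) measure" where
  "coin_space = Pi\<^sub>M ([pos_nats]\<^bsup>2\<^esup>) (\<lambda>_. measure_pmf (bernoulli_pmf (1/2)))"

definition random_graph :: "(nat set \<Rightarrow> bool) \<Rightarrow> nat graph" where
  "random_graph \<omega> = (pos_nats, {e \<in> [pos_nats]\<^bsup>2\<^esup>. \<omega> e})"

definition almost_every_graph :: "(nat graph \<Rightarrow> bool) \<Rightarrow> bool" where
  "almost_every_graph P \<longleftrightarrow> (AE \<omega> in coin_space. P (random_graph \<omega>))"

lemma weakly_universal_any_type:
  fixes G :: "'a graph" and H :: "'b graph"
  assumes "weakly_universal G A" "finite_graph H"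
  shows "contains_induced (induced_subgraph G A) H"
proof -
  have fin: "finite (verts H)" and sub: "edges H \<subseteq> [verts H]\<^bsup>2\<^esup>"
    using assms(2) by (auto simp: finite_graph_def simple_graph_def)
  obtain g :: "'b \<Rightarrow> nat" where inj: "inj_on g (verts H)"
    using finite_imp_inj_to_nat_seg[OF fin] by blast
  define K :: "nat graph" where "K = (g ` verts H, (`) g ` edges H)"
  have "finite_graph K"
    unfolding finite_graph_def simple_graph_def K_def
    using fin sub inj by (auto simp: nsets_def card_image inj_on_subset)
  then obtain S f where S: "S \<subseteq> A"
    and f: "bij_betw f S (g ` verts H)"
    and e: "\<And>u v. u \<in> S \<Longrightarrow> v \<in> S \<Longrightarrow>
      {u, v} \<in> edges (induced_subgraph (induced_subgraph G A) S) \<longleftrightarrow> {f u, f v} \<in> edges K"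
    using assms(1)
    unfolding weakly_universal_def contains_induced_def graph_isomorphic_def
    by (auto simp: induced_subgraph_def K_def) metis
  define h where "h = inv_into (verts H) g"
  have h: "bij_betw h (g ` verts H) (verts H)"
    unfolding h_def using inj by (simp add: bij_betw_inv_into inj_on_imp_bij_betw)
  have K: "{x, y} \<in> edges K \<longleftrightarrow> {h x, h y} \<in> edges H"
    if x: "x \<in> g ` verts H" and y: "y \<in> g ` verts H" for x y
  proof -
    have gh: "g (h x) = x" "g (h y) = y" and hv: "h x \<in> verts H" "h y \<in> verts H"
      using x y inj by (auto simp: h_def f_inv_into_f)
    have "{x, y} = g ` {h x, h y}" using gh by simp
    moreover have "g ` {h x, h y} \<in> (`) g ` edges H \<longleftrightarrow> {h x, h y} \<in> edges H"
    proof
      assume "g ` {h x, h y} \<in> (`) g ` edges H"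
      then obtain d where d: "d \<in> edges H" "g ` {h x, h y} = g ` d" by blast
      have "d \<subseteq> verts H" using d(1) sub by (auto simp: nsets_def)
      then have "{h x, h y} = d"
        using inj_on_image_eq_iff[OF inj, of "{h x, h y}" d] d(2) hv by auto
      then show "{h x, h y} \<in> edges H" using d(1) by simp
    qed blast
    ultimately show ?thesis by (simp add: K_def)
  qed
  have "graph_isomorphic (induced_subgraph (induced_subgraph G A) S) H"
    unfolding graph_isomorphic_def
  proof (intro exI[of _ "h \<circ> f"] conjI ballI)
    show "bij_betw (h \<circ> f) (verts (induced_subgraph (induced_subgraph G A) S)) (verts H)"
      using bij_betw_trans[OF f h] by (simp add: induced_subgraph_def)
    fix u v
    assume "u \<in> verts (induced_subgraph (induced_subgraph G A) S)"
      and "v \<in> verts (induced_subgraph (induced_subgraph G A) S)"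
    then have uv: "u \<in> S" "v \<in> S" by (auto simp: induced_subgraph_def)
    then have "f u \<in> g ` verts H" "f v \<in> g ` verts H" using f by (auto simp: bij_betw_def)
    then show "{u, v} \<in> edges (induced_subgraph (induced_subgraph G A) S) \<longleftrightarrow>
        {(h \<circ> f) u, (h \<circ> f) v} \<in> edges H"
      using e[OF uv] K by simp
  qed
  then show ?thesis unfolding contains_induced_def using S by (auto simp: induced_subgraph_def)
qed

end

theory Submission
  imports Defs "HOL-Real_Asymp.Real_Asymp"
begin

text \<open>Fix a finite graph \<open>H\<close> on \<open>k\<close> vertices. Any \<open>k\<^sup>2 q\<close> vertices contain \<open>q\<^sup>2\<close> pairwise
  edge-disjoint \<open>k\<close>-subsets, so they avoid \<open>H\<close> with probability at most \<open>exp (- c q\<^sup>2)\<close>.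
  For \<open>q \<approx> 2\<^sup>j / j\<^sup>2\<close> this beats the \<open>2 ^ 2\<^sup>j\<close> subsets of the dyadic block \<open>[2\<^sup>j, 2\<^sup>j\<^sup>+\<^sup>1)\<close>, and by
  Borel--Cantelli almost surely every \<open>H\<close>-free set has only \<open>O(2\<^sup>j / j\<^sup>2)\<close> elements in all but
  finitely many blocks. Such a set has a convergent sum of reciprocals.\<close>

section \<open>Independent fair coins\<close>

text \<open>Coins inside a block are independent, so agreement with \<open>\<tau>\<close> there has
  probability \<open>(1/2)^d\<close>. Disjoint blocks see independent families of coins, so the
  mismatch probabilities multiply. The blocks will be the edge sets of potential copies of a
  graph.\<close>

lemma (in prob_space) prob_all_blocks_mismatch:
  fixes X :: "'i \<Rightarrow> 'a \<Rightarrow> bool" and D :: "'t \<Rightarrow> 'i set"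
  assumes indep: "indep_vars (\<lambda>_. count_space UNIV) X I"
    and fair: "\<And>i b. i \<in> I \<Longrightarrow> prob {\<omega> \<in> space M. X i \<omega> = b} = 1/2"
    and D: "\<And>t. t \<in> T \<Longrightarrow> D t \<subseteq> I" "\<And>t. t \<in> T \<Longrightarrow> finite (D t)"
      "\<And>t. t \<in> T \<Longrightarrow> card (D t) = d"
    and disj: "disjoint_family_on D T" and "finite T"
  shows "{\<omega> \<in> space M. \<forall>t\<in>T. \<exists>i\<in>D t. X i \<omega> \<noteq> \<tau> t i} \<in> events"
    and "prob {\<omega> \<in> space M. \<forall>t\<in>T. \<exists>i\<in>D t. X i \<omega> \<noteq> \<tau> t i} = (1 - (1/2)^d) ^ card T"
proof -
  have X: "X i \<in> measurable M (count_space UNIV)" if "i \<in> I" for i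
    using indep that by (auto simp: indep_vars_def)
  have [measurable]: "X i \<in> measurable M (count_space UNIV)" if "i \<in> D t" "t \<in> T" for i t
    using X D(1) that by blast
  have agree: "prob {\<omega> \<in> space M. \<forall>i\<in>D t. X i \<omega> = \<tau> t i} = (1/2)^d" if t: "t \<in> T" for t
  proof (cases "D t = {}")
    case True
    then show ?thesis using D(3)[OF t] by (auto simp: prob_space)
  next
    case False
    have "prob (\<Inter>i\<in>D t. X i -` {\<tau> t i} \<inter> space M) = (\<Prod>i\<in>D t. prob (X i -` {\<tau> t i} \<inter> space M))"
      using False D t by (intro indep_varsD[OF indep]) auto
    also have "\<dots> = (\<Prod>i\<in>D t. 1/2)"
    proof (rule prod.cong[OF refl])
      fix i assume "i \<in> D t"
      then have "prob {\<omega> \<in> space M. X i \<omega> = \<tau> t i} = 1/2" using fair D(1)[OF t] by blast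
      moreover have "X i -` {\<tau> t i} \<inter> space M = {\<omega> \<in> space M. X i \<omega> = \<tau> t i}" by auto
      ultimately show "prob (X i -` {\<tau> t i} \<inter> space M) = 1/2" by simp
    qed
    also have "(\<Inter>i\<in>D t. X i -` {\<tau> t i} \<inter> space M) = {\<omega> \<in> space M. \<forall>i\<in>D t. X i \<omega> = \<tau> t i}"
      using False by auto
    finally show ?thesis using D(3)[OF t] by simp
  qed
  have mism_ev: "{\<omega> \<in> space M. \<exists>i\<in>D t. X i \<omega> \<noteq> \<tau> t i} \<in> events" if "t \<in> T" for t
    using that D(2)[OF that] by measurable
  have mism: "prob {\<omega> \<in> space M. \<exists>i\<in>D t. X i \<omega> \<noteq> \<tau> t i} = 1 - (1/2)^d" if t: "t \<in> T" for t
  proof -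
    have "{\<omega> \<in> space M. \<forall>i\<in>D t. X i \<omega> = \<tau> t i} \<in> events"
      using t D(2)[OF t] by measurable
    note prob_compl[OF this]
    moreover have "{\<omega> \<in> space M. \<exists>i\<in>D t. X i \<omega> \<noteq> \<tau> t i}
        = space M - {\<omega> \<in> space M. \<forall>i\<in>D t. X i \<omega> = \<tau> t i}" by auto
    ultimately show ?thesis using agree[OF t] by simp
  qed
  show "{\<omega> \<in> space M. \<forall>t\<in>T. \<exists>i\<in>D t. X i \<omega> \<noteq> \<tau> t i} \<in> events"
    using \<open>finite T\<close> mism_ev by (intro sets.sets_Collect_finite_All) auto
  show "prob {\<omega> \<in> space M. \<forall>t\<in>T. \<exists>i\<in>D t. X i \<omega> \<noteq> \<tau> t i} = (1 - (1/2)^d) ^ card T"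
  proof (cases "T = {}")
    case True
    then show ?thesis by (simp add: prob_space)
  next
    case False
    \<comment> \<open>The mismatch event read as a set of coin vectors indexed by
      \<open>D t\<close>; restrictions to disjoint index sets are independent.\<close>
    define A where "A t = {f \<in> space (PiM (D t) (\<lambda>_. count_space UNIV)). \<exists>i\<in>D t. f i \<noteq> \<tau> t i}" for t
    have A: "A t \<in> sets (PiM (D t) (\<lambda>_. count_space UNIV))" if "t \<in> T" for t
      unfolding A_def using D(2)[OF that] by measurable
    have pre: "(\<lambda>\<omega>. restrict (\<lambda>i. X i \<omega>) (D t)) -` A t \<inter> space M
        = {\<omega> \<in> space M. \<exists>i\<in>D t. X i \<omega> \<noteq> \<tau> t i}" for t
      by (auto simp: A_def space_PiM)
    have "prob (\<Inter>t\<in>T. (\<lambda>\<omega>. restrict (\<lambda>i. X i \<omega>) (D t)) -` A t \<inter> space M)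
        = (\<Prod>t\<in>T. prob ((\<lambda>\<omega>. restrict (\<lambda>i. X i \<omega>) (D t)) -` A t \<inter> space M))"
      using False \<open>finite T\<close> A
      by (intro indep_varsD_finite[OF indep_vars_restrict[OF indep D(1) disj]]) auto
    also have "\<dots> = (\<Prod>t\<in>T. 1 - (1/2)^d)"
      unfolding pre using mism by (intro prod.cong) auto
    also have "(\<Inter>t\<in>T. (\<lambda>\<omega>. restrict (\<lambda>i. X i \<omega>) (D t)) -` A t \<inter> space M)
        = {\<omega> \<in> space M. \<forall>t\<in>T. \<exists>i\<in>D t. X i \<omega> \<noteq> \<tau> t i}"
      unfolding pre using False by auto
    finally show ?thesis by simp
  qed
qed

lemma prob_space_coin_space: "prob_space coin_space"
  unfolding coin_space_def by (intro prob_space_PiM prob_space_measure_pmf)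

interpretation coin: prob_space coin_space
  by (rule prob_space_coin_space)

text \<open>Independence amounts to the joint law being the product of the marginals; here the joint
  law of the coordinates is \<open>coin_space\<close> itself.\<close>

lemma coin_space_indep:
  "coin.indep_vars (\<lambda>_. count_space UNIV) (\<lambda>e \<omega>. \<omega> e) ([pos_nats]\<^bsup>2\<^esup>)"
proof -
  let ?I = "[pos_nats]\<^bsup>2\<^esup>" and ?B = "measure_pmf (bernoulli_pmf (1/2))"
  have "{1, 2::nat} \<in> ?I" by (auto simp: nsets_def)
  then have ne: "?I \<noteq> {}" by blast
  have rv: "(\<lambda>\<omega>. \<omega> e) \<in> measurable coin_space ?B" if "e \<in> ?I" for e
    using that unfolding coin_space_def by measurable
  \<comment> \<open>Points of the product space are extensional, so restricting to \<open>?I\<close>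
    changes nothing.\<close>
  have "distr coin_space (PiM ?I (\<lambda>_. ?B)) (\<lambda>\<omega>. \<lambda>e\<in>?I. \<omega> e) = distr coin_space (PiM ?I (\<lambda>_. ?B)) (\<lambda>\<omega>. \<omega>)"
    by (intro distr_cong) (auto simp: coin_space_def space_PiM)
  also have "\<dots> = coin_space"
    unfolding coin_space_def by (rule distr_id)
  also have "\<dots> = PiM ?I (\<lambda>e. distr coin_space ?B (\<lambda>\<omega>. \<omega> e))"
    unfolding coin_space_def
    by (intro PiM_cong refl distr_PiM_component[symmetric] prob_space_measure_pmf)
  finally have "coin.indep_vars (\<lambda>_. ?B) (\<lambda>e \<omega>. \<omega> e) ?I"
    using coin.indep_vars_iff_distr_eq_PiM'[OF ne, where M' = "\<lambda>_. ?B" and X = "\<lambda>e \<omega>. \<omega> e"] rv by simp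
  then show ?thesis
    by (rule coin.indep_vars_compose2[where Y = "\<lambda>_ b. b"]) simp
qed

lemma coin_space_fair:
  assumes "e \<in> [pos_nats]\<^bsup>2\<^esup>"
  shows "measure coin_space {\<omega> \<in> space coin_space. \<omega> e = b} = 1/2"
proof -
  let ?B = "measure_pmf (bernoulli_pmf (1/2))"
  have rv: "(\<lambda>\<omega>. \<omega> e) \<in> measurable coin_space ?B"
    using assms unfolding coin_space_def by measurable
  have "measure ?B {b} = measure (distr coin_space ?B (\<lambda>\<omega>. \<omega> e)) {b}"
    using distr_PiM_component[of "[pos_nats]\<^bsup>2\<^esup>" "\<lambda>_. ?B" e] assms
    by (simp add: coin_space_def prob_space_measure_pmf)
  also have "\<dots> = measure coin_space {\<omega> \<in> space coin_space. \<omega> e = b}"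
    by (subst measure_distr[OF rv]) (auto intro: arg_cong[of _ _ "measure coin_space"])
  finally show ?thesis
    by (cases b) (simp_all add: measure_pmf_single)
qed

section \<open>Induced copies of a finite graph\<close>

lemma contains_induced_mono:
  assumes "contains_induced (induced_subgraph G S) H" "S \<subseteq> A"
  shows "contains_induced (induced_subgraph G A) H"
proof -
  obtain R where R: "R \<subseteq> S" "graph_isomorphic (induced_subgraph (induced_subgraph G S) R) H"
    using assms(1) by (auto simp: contains_induced_def induced_subgraph_def)
  moreover have "induced_subgraph (induced_subgraph G S) R = induced_subgraph (induced_subgraph G A) R"
    using R(1) assms(2) by (auto simp: induced_subgraph_def)
  ultimately show ?thesis
    using assms(2) by (auto simp: contains_induced_def induced_subgraph_def)
qed

text \<open>Lets the almost sure events for the single graphs \<open>H\<close> be intersected over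
  all \<open>H\<close>.\<close>

lemma countable_finite_graphs: "countable {H :: nat graph. finite_graph H}"
proof (rule countable_subset)
  let ?F = "{A :: nat set. finite A}"
  show "{H :: nat graph. finite_graph H} \<subseteq> ?F \<times> {E. finite E \<and> E \<subseteq> ?F}"
  proof
    fix H :: "nat graph"
    assume "H \<in> {H. finite_graph H}"
    then have fin: "finite (verts H)" and sub: "edges H \<subseteq> [verts H]\<^bsup>2\<^esup>"
      by (auto simp: finite_graph_def simple_graph_def)
    have "finite (edges H)"
      using sub finite_imp_finite_nsets[OF fin] by (rule finite_subset)
    moreover have "edges H \<subseteq> ?F" using sub by (auto simp: nsets_def)
    ultimately show "H \<in> ?F \<times> {E. finite E \<and> E \<subseteq> ?F}" using fin by (simp add: mem_Times_iff)
  qed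
  show "countable (?F \<times> {E. finite E \<and> E \<subseteq> ?F})"
    by (intro countable_SIGMA countable_Collect_finite countable_Collect_finite_subset)
qed

text \<open>Here \<open>h\<close> numbers the vertices of \<open>H\<close> and \<open>\<phi>\<close>
  places the numbers in \<open>S\<close>; undoing \<open>\<phi>\<close> and then applying
  \<open>h\<close> is the isomorphism. The condition \<open>agree\<close> concerns only the coins of
  one block.\<close>

lemma contains_induced_random_graphI:
  assumes H: "finite_graph H" and h: "bij_betw h {..<k} (verts H)"
    and \<phi>: "inj_on \<phi> {..<k}" "\<phi> ` {..<k} \<subseteq> S" and S: "S \<subseteq> pos_nats"
    and agree: "\<And>p. p \<in> [{..<k}]\<^bsup>2\<^esup> \<Longrightarrow> \<omega> (\<phi> ` p) \<longleftrightarrow> h ` p \<in> edges H"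
  shows "contains_induced (induced_subgraph (random_graph \<omega>) S) H"
proof -
  let ?G = "induced_subgraph (induced_subgraph (random_graph \<omega>) S) (\<phi> ` {..<k})"
  define g where "g = h \<circ> inv_into {..<k} \<phi>"
  have g: "g (\<phi> i) = h i" if "i < k" for i
    using \<phi>(1) that by (simp add: g_def)
  have "bij_betw g (\<phi> ` {..<k}) (verts H)"
    unfolding g_def using \<phi>(1) by (intro bij_betw_trans[OF _ h] bij_betw_inv_into inj_on_imp_bij_betw)
  moreover have "{u, v} \<in> edges ?G \<longleftrightarrow> {g u, g v} \<in> edges H"
    if uv: "u \<in> \<phi> ` {..<k}" "v \<in> \<phi> ` {..<k}" for u v
  proof -
    obtain i j where ij: "i < k" "j < k" "u = \<phi> i" "v = \<phi> j" using uv by auto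
    show ?thesis
    \<comment> \<open>\<open>graph_isomorphic\<close> also compares \<open>u = v\<close>, where the
      pair collapses to a singleton, an edge of neither graph.\<close>
    proof (cases "i = j")
      case True
      have "{h j} \<notin> edges H"
        using H by (auto simp: finite_graph_def simple_graph_def nsets_def)
      then show ?thesis
        using True ij g by (auto simp: induced_subgraph_def random_graph_def nsets_def)
    next
      case False
      then have "{i, j} \<in> [{..<k}]\<^bsup>2\<^esup>" using ij by (auto simp: nsets_def)
      from agree[OF this] have "\<omega> {u, v} \<longleftrightarrow> {g u, g v} \<in> edges H"
        using ij g by simp
      moreover have "u \<noteq> v" using False ij \<phi>(1) by (auto simp: inj_on_def)
      then have "{u, v} \<in> [pos_nats]\<^bsup>2\<^esup>" using uv \<phi>(2) S by (auto simp: nsets_def)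
      ultimately show ?thesis
        using uv \<phi>(2) by (auto simp: induced_subgraph_def random_graph_def)
    qed
  qed
  ultimately have "graph_isomorphic ?G H"
    unfolding graph_isomorphic_def by (intro exI[of _ g]) (simp add: induced_subgraph_def)
  then show ?thesis
    using \<phi>(2) by (auto simp: contains_induced_def induced_subgraph_def)
qed

text \<open>Place the vertices on a \<open>k \<times> kq\<close> grid. The \<open>q\<^sup>2\<close> lines \<open>i \<mapsto> a + b i\<close> with \<open>a, b < q\<close>
  pairwise meet in at most one point, so they carry edge-disjoint potential copies.\<close>

lemma lines_edge_disjoint:
  fixes q k :: nat
  obtains \<phi> :: "nat \<times> nat \<Rightarrow> nat \<Rightarrow> nat"
  where "\<And>t. t \<in> {..<q} \<times> {..<q} \<Longrightarrow> inj_on (\<phi> t) {..<k}"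
    and "\<And>t. t \<in> {..<q} \<times> {..<q} \<Longrightarrow> \<phi> t ` {..<k} \<subseteq> {..<k\<^sup>2 * q}"
    and "disjoint_family_on (\<lambda>t. (`) (\<phi> t) ` [{..<k}]\<^bsup>2\<^esup>) ({..<q} \<times> {..<q})"
proof
  \<comment> \<open>The width of a grid row: column \<open>a + b * i\<close> of row \<open>i\<close>
    is encoded as \<open>i * m + (a + b * i)\<close>, and all columns used stay below
    \<open>m\<close>.\<close>
  define m where "m = q * k"
  define \<phi> where "\<phi> = (\<lambda>(a, b) i. i * m + (a + b * i))"
  have lt: "a + b * i < m" if "a < q" "b < q" "i < k" for a b i
  proof -
    have "b * i \<le> (q - 1) * (k - 1)" using that by (intro mult_mono) auto
    then have "a + b * i \<le> (q - 1) + (q - 1) * (k - 1)" using that by simp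
    also have "\<dots> = (q - 1) * k" using that by (cases k) auto
    also have "\<dots> < m" unfolding m_def using that by simp
    finally show ?thesis .
  qed
  \<comment> \<open>Quotient and remainder by \<open>m\<close> recover row and column, so lines can
    be compared row by row.\<close>
  have dm: "\<phi> t i div m = i" "\<phi> t i mod m = fst t + snd t * i"
    if "t \<in> {..<q} \<times> {..<q}" "i < k" for t i
    using lt[of "fst t" "snd t" i] that by (auto simp: \<phi>_def)
  show inj: "inj_on (\<phi> t) {..<k}" if "t \<in> {..<q} \<times> {..<q}" for t
    using dm(1)[OF that] by (metis inj_onI lessThan_iff)
  show "\<phi> t ` {..<k} \<subseteq> {..<k\<^sup>2 * q}" if t: "t \<in> {..<q} \<times> {..<q}" for t
  proof (safe, simp)
    fix i assume i: "i < k"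
    have "\<phi> t i < Suc i * m" using lt[of "fst t" "snd t" i] t i by (auto simp: \<phi>_def)
    also have "\<dots> \<le> k * m" using i by (intro mult_right_mono) auto
    finally show "\<phi> t i < k\<^sup>2 * q" by (simp add: m_def power2_eq_square mult_ac)
  qed
  show "disjoint_family_on (\<lambda>t. (`) (\<phi> t) ` [{..<k}]\<^bsup>2\<^esup>) ({..<q} \<times> {..<q})"
    unfolding disjoint_family_on_def
  proof (intro ballI impI, rule ccontr)
    fix s t assume s: "s \<in> {..<q} \<times> {..<q}" and t: "t \<in> {..<q} \<times> {..<q}" and "s \<noteq> t"
      and "(`) (\<phi> s) ` [{..<k}]\<^bsup>2\<^esup> \<inter> (`) (\<phi> t) ` [{..<k}]\<^bsup>2\<^esup> \<noteq> {}"
    then obtain p p' where p: "p \<in> [{..<k}]\<^bsup>2\<^esup>" "p' \<in> [{..<k}]\<^bsup>2\<^esup>" "\<phi> s ` p = \<phi> t ` p'"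
      by blast
    from p(1) have "p \<subseteq> {..<k}" "card p = 2" by (simp_all add: nsets_def)
    moreover from this obtain i j where "p = {i, j}" and "i \<noteq> j"
      unfolding card_2_iff by blast
    ultimately have ij: "p = {i, j}" "i \<noteq> j" "i < k" "j < k"
      by simp_all
    \<comment> \<open>A point shared by two lines has one row number, hence the same index on both,
      so the columns agree there.\<close>
    have same: "fst s + snd s * i = fst t + snd t * i" if "i \<in> p" for i
    proof -
      have "\<phi> s i \<in> \<phi> t ` p'" unfolding p(3)[symmetric] using that by (rule imageI)
      then obtain i' where i': "i' \<in> p'" "\<phi> s i = \<phi> t i'" by (rule imageE)
      have "i < k" "i' < k" using p that i' by (auto simp: nsets_def)
      then show ?thesis using dm[OF s] dm[OF t] i' by metis
    qed
    \<comment> \<open>Subtracting the equations for the two distinct rows gives equal slopes, then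
      equal intercepts; integers avoid truncated subtraction.\<close>
    have "int (fst s) + int (snd s) * int i = int (fst t) + int (snd t) * int i"
      using same[of i] ij by (metis insertI1 of_nat_add of_nat_mult)
    moreover have "int (fst s) + int (snd s) * int j = int (fst t) + int (snd t) * int j"
      using same[of j] ij by (metis insertI1 insert_commute of_nat_add of_nat_mult)
    ultimately have "(int (snd s) - int (snd t)) * (int i - int j) = 0"
      by (simp add: algebra_simps)
    then have "snd s = snd t" using ij by simp
    then have "s = t" using same[of i] ij by (simp add: prod_eq_iff)
    with \<open>s \<noteq> t\<close> show False by simp
  qed
qed

section \<open>Probability of avoiding a finite graph\<close>

text \<open>The \<open>q^2\<close> edge-disjoint placements fail independently, each with
  probability \<open>1 - (1/2)^(k choose 2)\<close>. \<open>B\<close> is the event that all of them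
  fail, a measurable set containing every outcome for which \<open>S\<close> has no copy.\<close>

lemma prob_no_copy_le:
  assumes H: "finite_graph H" and k: "card (verts H) = k"
    and S: "finite S" "S \<subseteq> pos_nats" "card S \<ge> k\<^sup>2 * q"
  obtains B where "B \<in> sets coin_space"
    and "measure coin_space B \<le> exp (- ((1/2) ^ (k choose 2) * (real q)\<^sup>2))"
    and "\<And>\<omega>. \<omega> \<in> space coin_space - B \<Longrightarrow> contains_induced (induced_subgraph (random_graph \<omega>) S) H"
proof -
  obtain \<phi> :: "nat \<times> nat \<Rightarrow> nat \<Rightarrow> nat"
    where \<phi>: "\<And>t. t \<in> {..<q} \<times> {..<q} \<Longrightarrow> inj_on (\<phi> t) {..<k}"
      "\<And>t. t \<in> {..<q} \<times> {..<q} \<Longrightarrow> \<phi> t ` {..<k} \<subseteq> {..<k\<^sup>2 * q}"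
      "disjoint_family_on (\<lambda>t. (`) (\<phi> t) ` [{..<k}]\<^bsup>2\<^esup>) ({..<q} \<times> {..<q})"
    using lines_edge_disjoint[of q k] by metis
  define T where "T = {..<q} \<times> {..<q}"
  have finH: "finite (verts H)" using H by (simp add: finite_graph_def)
  obtain h where h: "bij_betw h {..<k} (verts H)"
    using ex_bij_betw_nat_finite[OF finH] k by (auto simp: atLeast0LessThan)
  obtain \<sigma> where "bij_betw \<sigma> {..<card S} S"
    using ex_bij_betw_nat_finite[OF S(1)] by (auto simp: atLeast0LessThan)
  then have \<sigma>: "inj_on \<sigma> {..<k\<^sup>2 * q}" "\<sigma> ` {..<k\<^sup>2 * q} \<subseteq> S"
    using S(3) by (auto simp: bij_betw_def elim: inj_on_subset)
  define \<psi> where "\<psi> t = \<sigma> \<circ> \<phi> t" for t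
  have \<psi>_inj: "inj_on (\<psi> t) {..<k}" and \<psi>_sub: "\<psi> t ` {..<k} \<subseteq> S" if "t \<in> T" for t
    using \<phi>(1,2)[of t] \<sigma> that unfolding \<psi>_def T_def
    by (auto intro!: comp_inj_on elim: inj_on_subset)
  \<comment> \<open>Used twice: \<open>D t\<close> has exactly one edge for each pair of indices,
    and \<open>inv_into\<close> in \<open>\<tau>\<close> recovers that pair.\<close>
  have img_inj: "inj_on ((`) (\<psi> t)) ([{..<k}]\<^bsup>2\<^esup>)" if "t \<in> T" for t
    using inj_on_image_Pow[OF \<psi>_inj[OF that]] by (rule inj_on_subset) (auto simp: nsets_def)
  define D where "D t = (`) (\<psi> t) ` [{..<k}]\<^bsup>2\<^esup>" for t
  \<comment> \<open>The value that coin \<open>e\<close> must take for placement \<open>t\<close> to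
    be a copy: pull \<open>e\<close> back to a pair of indices and look up its image under
    \<open>h\<close> in \<open>H\<close>.\<close>
  define \<tau> where "\<tau> t e \<longleftrightarrow> h ` inv_into ([{..<k}]\<^bsup>2\<^esup>) ((`) (\<psi> t)) e \<in> edges H" for t e
  define B where "B = {\<omega> \<in> space coin_space. \<forall>t\<in>T. \<exists>e\<in>D t. \<omega> e \<noteq> \<tau> t e}"
  have fink: "finite ([{..<k}]\<^bsup>2\<^esup>)" by (simp add: finite_imp_finite_nsets)
  have Dsub: "D t \<subseteq> [pos_nats]\<^bsup>2\<^esup>" if "t \<in> T" for t
  proof
    fix e assume "e \<in> D t"
    then obtain p where p: "p \<subseteq> {..<k}" "card p = 2" "e = \<psi> t ` p" by (auto simp: D_def nsets_def)
    then have "card e = 2" using \<psi>_inj[OF that] by (metis card_image inj_on_subset)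
    moreover have "e \<subseteq> pos_nats" using p \<psi>_sub[OF that] S(2) by blast
    ultimately show "e \<in> [pos_nats]\<^bsup>2\<^esup>" by (auto simp: nsets_def intro: card_ge_0_finite)
  qed
  have Dfin: "finite (D t)" for t unfolding D_def using fink by simp
  have Dcard: "card (D t) = k choose 2" if "t \<in> T" for t
    unfolding D_def using card_image[OF img_inj[OF that]] by simp
  \<comment> \<open>Disjointness is known on the grid; it passes to \<open>S\<close> because images
    under the injective \<open>\<sigma>\<close> commute with intersections.\<close>
  have D\<phi>: "D t = (`) \<sigma> ` (`) (\<phi> t) ` [{..<k}]\<^bsup>2\<^esup>" for t
    by (simp add: D_def \<psi>_def image_comp comp_def)
  have Ddisj: "disjoint_family_on D T"
    unfolding disjoint_family_on_def
  proof (intro ballI impI)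
    fix s t assume st: "s \<in> T" "t \<in> T" "s \<noteq> t"
    have sub: "(`) (\<phi> u) ` [{..<k}]\<^bsup>2\<^esup> \<subseteq> Pow {..<k\<^sup>2 * q}" if "u \<in> T" for u
    proof -
      have "\<phi> u ` p \<subseteq> {..<k\<^sup>2 * q}" if "p \<subseteq> {..<k}" for p
        using \<phi>(2)[of u] \<open>u \<in> T\<close> that unfolding T_def by blast
      then show ?thesis by (auto simp: nsets_def)
    qed
    have "(`) (\<phi> s) ` [{..<k}]\<^bsup>2\<^esup> \<inter> (`) (\<phi> t) ` [{..<k}]\<^bsup>2\<^esup> = {}"
      using disjoint_family_onD[OF \<phi>(3)] st by (simp add: T_def)
    then show "D s \<inter> D t = {}"
      unfolding D\<phi>
      using inj_on_image_Int[OF inj_on_image_Pow[OF \<sigma>(1)] sub[OF st(1)] sub[OF st(2)]] by simp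
  qed
  note mis = coin.prob_all_blocks_mismatch[OF coin_space_indep coin_space_fair Dsub Dfin Dcard Ddisj, of \<tau>]
  have finT: "finite T" and cardT: "card T = q\<^sup>2"
    by (simp_all add: T_def card_cartesian_product power2_eq_square)
  have "measure coin_space B = (1 - (1/2) ^ (k choose 2)) ^ q\<^sup>2"
    unfolding B_def using mis(2) finT cardT by simp
  \<comment> \<open>From \<open>1 + x \<le> exp x\<close> at
    \<open>x = - (1/2)^(k choose 2)\<close>.\<close>
  also have "\<dots> \<le> exp (- ((1/2) ^ (k choose 2))) ^ q\<^sup>2"
    using exp_ge_add_one_self[of "- ((1/2) ^ (k choose 2))"]
    by (intro power_mono) (auto simp: power_le_one)
  also have "\<dots> = exp (- ((1/2) ^ (k choose 2) * (real q)\<^sup>2))"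
    by (simp add: exp_of_nat_mult[symmetric] mult.commute)
  finally have le: "measure coin_space B \<le> exp (- ((1/2) ^ (k choose 2) * (real q)\<^sup>2))" .
  show ?thesis
  proof
    show "B \<in> sets coin_space" unfolding B_def using mis(1) finT by simp
    show "measure coin_space B \<le> exp (- ((1/2) ^ (k choose 2) * (real q)\<^sup>2))" by (fact le)
    fix \<omega> assume "\<omega> \<in> space coin_space - B"
    then obtain t where t: "t \<in> T" "\<And>e. e \<in> D t \<Longrightarrow> \<omega> e = \<tau> t e"
      unfolding B_def by blast
    show "contains_induced (induced_subgraph (random_graph \<omega>) S) H"
    proof (rule contains_induced_random_graphI[OF H h \<psi>_inj[OF t(1)] \<psi>_sub[OF t(1)] S(2)])
      fix p assume p: "p \<in> [{..<k}]\<^bsup>2\<^esup>"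
      then show "\<omega> (\<psi> t ` p) \<longleftrightarrow> h ` p \<in> edges H"
        using t(2)[of "\<psi> t ` p"] img_inj[OF t(1)] by (simp add: D_def \<tau>_def)
    qed
  qed
qed

text \<open>Union bound over the at most \<open>2 ^ card V\<close> large subsets. A single
  exceptional set serves all \<open>S\<close>, so \<open>S\<close> may later depend on the
  graph.\<close>

lemma prob_some_subset_without_copy_le:
  assumes H: "finite_graph H" and k: "card (verts H) = k"
    and V: "finite V" "V \<subseteq> pos_nats"
  obtains B where "B \<in> sets coin_space"
    and "measure coin_space B \<le> 2 ^ card V * exp (- ((1/2) ^ (k choose 2) * (real q)\<^sup>2))"
    and "\<And>\<omega> S. \<omega> \<in> space coin_space - B \<Longrightarrow> S \<subseteq> V \<Longrightarrow> card S \<ge> k\<^sup>2 * q \<Longrightarrow>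
      contains_induced (induced_subgraph (random_graph \<omega>) S) H"
proof -
  let ?p = "exp (- ((1/2) ^ (k choose 2) * (real q)\<^sup>2))"
  define F where "F = {S \<in> Pow V. card S \<ge> k\<^sup>2 * q}"
  have F: "finite F" "card F \<le> 2 ^ card V"
    using V(1) card_mono[of "Pow V" F] by (auto simp: F_def card_Pow)
  have "\<exists>B. B \<in> sets coin_space \<and> measure coin_space B \<le> ?p \<and>
      (\<forall>\<omega> \<in> space coin_space - B. contains_induced (induced_subgraph (random_graph \<omega>) S) H)"
    if "S \<in> F" for S
  proof -
    have "finite S" "S \<subseteq> pos_nats" "card S \<ge> k\<^sup>2 * q"
      using that V by (auto simp: F_def intro: finite_subset)
    from prob_no_copy_le[OF H k this] show ?thesis by metis
  qed
  then obtain B where B: "\<And>S. S \<in> F \<Longrightarrow> B S \<in> sets coin_space"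
    "\<And>S. S \<in> F \<Longrightarrow> measure coin_space (B S) \<le> ?p"
    "\<And>S \<omega>. S \<in> F \<Longrightarrow> \<omega> \<in> space coin_space - B S \<Longrightarrow>
      contains_induced (induced_subgraph (random_graph \<omega>) S) H"
    by metis
  show ?thesis
  proof
    show "(\<Union>S\<in>F. B S) \<in> sets coin_space" using B(1) F(1) by blast
    have "measure coin_space (\<Union>S\<in>F. B S) \<le> (\<Sum>S\<in>F. measure coin_space (B S))"
      using B(1) F(1) by (intro coin.finite_measure_subadditive_finite) auto
    also have "\<dots> \<le> (\<Sum>S\<in>F. ?p)" by (intro sum_mono B(2))
    also have "\<dots> = real (card F) * ?p" by simp
    also have "\<dots> \<le> 2 ^ card V * ?p"
    proof (rule mult_right_mono)
      show "real (card F) \<le> 2 ^ card V"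
        using F(2) by (metis of_nat_le_iff of_nat_numeral of_nat_power)
    qed simp
    finally show "measure coin_space (\<Union>S\<in>F. B S) \<le> 2 ^ card V * ?p" .
    fix \<omega> S assume "\<omega> \<in> space coin_space - (\<Union>S\<in>F. B S)" "S \<subseteq> V" "card S \<ge> k\<^sup>2 * q"
    then show "contains_induced (induced_subgraph (random_graph \<omega>) S) H"
      by (intro B(3)) (auto simp: F_def)
  qed
qed

section \<open>Dyadic blocks\<close>

text \<open>Reciprocals in block \<open>j\<close> are at most \<open>1 / 2^j\<close>, so the
  summable series bounds all finite sums, and in \<open>ennreal\<close> the infinite sum is their
  supremum. This will contradict divergence for a set that is sparse in the blocks.\<close>

lemma infsum_reciprocals_finite:
  assumes A: "A \<subseteq> pos_nats"
    and summ: "summable (\<lambda>j. real (card (A \<inter> {2^j..<2^Suc j})) / 2^j)"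
  shows "(\<Sum>\<^sub>\<infinity>n\<in>A. ennreal (1 / real n)) < \<infinity>"
proof -
  define u where "u j = real (card (A \<inter> {2^j..<2^Suc j})) / 2^j" for j
  have block: "(\<Sum>n\<in>A \<inter> {2^j..<2^Suc j}. 1 / real n) \<le> u j" for j
  proof -
    have "(\<Sum>n\<in>A \<inter> {2^j..<2^Suc j}. 1 / real n) \<le> (\<Sum>n\<in>A \<inter> {2^j..<2^Suc j}. 1 / 2^j)"
    proof (intro sum_mono divide_left_mono)
      fix n assume "n \<in> A \<inter> {2^j..<2^Suc j}"
      then have "2 ^ j \<le> n" by simp
      then show "2 ^ j \<le> real n" by (metis of_nat_le_iff of_nat_numeral of_nat_power)
      then have "0 < real n" by (rule less_le_trans[rotated]) simp
      then show "0 < real n * 2 ^ j" by simp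
    qed simp
    also have "\<dots> = u j" by (simp add: u_def)
    finally show ?thesis .
  qed
  have partial: "(\<Sum>n\<in>A \<inter> {1..<2^L}. 1 / real n) \<le> (\<Sum>j<L. u j)" for L
  proof (induction L)
    case 0
    show ?case by simp
  next
    case (Suc L)
    have "A \<inter> {1..<2^Suc L} = (A \<inter> {1..<2^L}) \<union> (A \<inter> {2^L..<2^Suc L})"
      by auto
    then have "(\<Sum>n\<in>A \<inter> {1..<2^Suc L}. 1 / real n)
        = (\<Sum>n\<in>A \<inter> {1..<2^L}. 1 / real n) + (\<Sum>n\<in>A \<inter> {2^L..<2^Suc L}. 1 / real n)"
      by (simp only:) (intro sum.union_disjoint, auto)
    then show ?case using Suc.IH block[of L] by simp
  qed
  have fin: "sum (\<lambda>n. ennreal (1 / real n)) F \<le> ennreal (suminf u)" if F: "finite F" "F \<subseteq> A" for F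
  proof -
    obtain L where L: "\<And>n. n \<in> F \<Longrightarrow> n < L"
      using F(1) unfolding finite_nat_set_iff_bounded by metis
    \<comment> \<open>Since \<open>n < L\<close> implies \<open>n < 2^L\<close>, the first
      \<open>L\<close> blocks cover \<open>F\<close>; zero is excluded by
      \<open>A \<subseteq> pos_nats\<close>.\<close>
    have "F \<subseteq> A \<inter> {1..<2^L}"
      using F(2) A L less_trans[OF _ less_exp] by fastforce
    then have "(\<Sum>n\<in>F. 1 / real n) \<le> (\<Sum>n\<in>A \<inter> {1..<2^L}. 1 / real n)"
      by (intro sum_mono2) auto
    also have "\<dots> \<le> (\<Sum>j<L. u j)" by (rule partial)
    also have "\<dots> \<le> suminf u"
      using summ by (intro sum_le_suminf) (auto simp: u_def[abs_def])
    finally show ?thesis by (simp add: sum_ennreal ennreal_leI)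
  qed
  have "(\<Sum>\<^sub>\<infinity>n\<in>A. ennreal (1 / real n)) \<le> ennreal (suminf u)"
    using fin by (subst nonneg_infsum_complete) (auto intro!: SUP_least)
  then show ?thesis by (simp add: order_le_less_trans)
qed

text \<open>The exponent grows like \<open>4^j / j^4\<close> and outweighs the
  \<open>2^j * ln 2\<close> coming from the number of subsets, so the terms eventually drop below
  \<open>(1/2)^j\<close>.\<close>

lemma summable_block_probs:
  assumes "c > 0"
  shows "summable (\<lambda>j. 2 ^ 2^j * exp (- (c * (real (2^j div (Suc j)\<^sup>2))\<^sup>2)))"
proof (rule summable_comparison_test_ev)
  show "summable (\<lambda>j. (1/2 :: real) ^ j)" by (simp add: summable_geometric)
  \<comment> \<open>The wanted bound after taking logarithms, with the integer quotient replaced by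
    the real quotient minus one.\<close>
  have "\<forall>\<^sub>F j in sequentially. ln 2 * 2^j + ln 2 * real j \<le> c * (2^j / (real j + 1)\<^sup>2 - 1)\<^sup>2"
    using assms by real_asymp
  \<comment> \<open>Nonnegativity allows the lower estimate of the quotient to be squared.\<close>
  moreover have "\<forall>\<^sub>F j in sequentially. 0 \<le> 2^j / (real j + 1)\<^sup>2 - 1"
    by real_asymp
  ultimately show "\<forall>\<^sub>F j in sequentially.
      norm (2 ^ 2^j * exp (- (c * (real (2^j div (Suc j)\<^sup>2))\<^sup>2))) \<le> (1/2) ^ j"
  proof eventually_elim
    case (elim j)
    let ?q = "2^j div (Suc j)\<^sup>2"
    have "real (2^j) / real ((Suc j)\<^sup>2) - 1 \<le> real ?q"
      using floor_divide_of_nat_eq[of "2^j" "(Suc j)\<^sup>2", where 'a = real] by linarith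
    then have "2^j / (real j + 1)\<^sup>2 - 1 \<le> real ?q" by (simp add: add.commute)
    then have "c * (2^j / (real j + 1)\<^sup>2 - 1)\<^sup>2 \<le> c * (real ?q)\<^sup>2"
      using elim(2) assms by (intro mult_left_mono power_mono) auto
    then have "ln 2 * 2^j - c * (real ?q)\<^sup>2 \<le> - (ln 2 * real j)" using elim(1) by linarith
    then have "exp (ln 2 * 2^j - c * (real ?q)\<^sup>2) \<le> exp (- (ln 2 * real j))" by simp
    moreover have "exp (ln 2 * 2^j - c * (real ?q)\<^sup>2) = 2 ^ 2^j * exp (- (c * (real ?q)\<^sup>2))"
      using exp_of_nat_mult[of "2^j" "ln 2 :: real"]
      by (simp add: exp_diff exp_minus field_simps)
    moreover have "exp (- (ln 2 * real j)) = (1/2) ^ j"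
      using exp_of_nat_mult[of j "ln 2 :: real"]
      by (simp add: exp_minus field_simps)
    ultimately show ?case by simp
  qed
qed

section \<open>Borel-Cantelli and the almost sure statement\<close>

text \<open>The choice \<open>q = 2^j div (Suc j)^2\<close> balances two demands: the failure
  probabilities are summable, so Borel-Cantelli applies, and the threshold density, at most
  \<open>k^2 / (Suc j)^2\<close>, is summable too. \<open>Suc j\<close> keeps the divisor positive
  at \<open>j = 0\<close>.\<close>

lemma AE_eventually_dense_subsets_contain:
  assumes H: "finite_graph H" and k: "card (verts H) = k"
  shows "AE \<omega> in coin_space. \<forall>\<^sub>F j in sequentially. \<forall>S \<subseteq> {2^j..<2^Suc j}.
    card S \<ge> k\<^sup>2 * (2^j div (Suc j)\<^sup>2) \<longrightarrow> contains_induced (induced_subgraph (random_graph \<omega>) S) H"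
proof -
  let ?p = "\<lambda>j. 2 ^ 2^j * exp (- ((1/2) ^ (k choose 2) * (real (2^j div (Suc j)\<^sup>2))\<^sup>2))"
  have "\<exists>B \<in> sets coin_space. measure coin_space B \<le> ?p j \<and>
      (\<forall>\<omega> \<in> space coin_space - B. \<forall>S \<subseteq> {2^j..<2^Suc j}. card S \<ge> k\<^sup>2 * (2^j div (Suc j)\<^sup>2) \<longrightarrow>
        contains_induced (induced_subgraph (random_graph \<omega>) S) H)" for j
  proof -
    have V: "finite {2^j..<2^Suc j :: nat}" "{2^j..<2^Suc j} \<subseteq> pos_nats" and c: "card {2^j..<2^Suc j :: nat} = 2^j"
      by (auto intro: order_trans[OF one_le_power])
    show ?thesis
      by (rule prob_some_subset_without_copy_le[OF H k V, of "2^j div (Suc j)\<^sup>2"], unfold c) blast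
  qed
  then obtain B where B: "\<And>j. B j \<in> sets coin_space" "\<And>j. measure coin_space (B j) \<le> ?p j"
    "\<And>j \<omega> S. \<omega> \<in> space coin_space - B j \<Longrightarrow> S \<subseteq> {2^j..<2^Suc j} \<Longrightarrow>
      card S \<ge> k\<^sup>2 * (2^j div (Suc j)\<^sup>2) \<Longrightarrow> contains_induced (induced_subgraph (random_graph \<omega>) S) H"
    by metis
  have "summable (\<lambda>j. measure coin_space (B j))"
    by (rule summable_comparison_test'[OF summable_block_probs[of "(1/2) ^ (k choose 2)"]])
      (use B(2) in auto)
  then have "AE \<omega> in coin_space. \<forall>\<^sub>F j in sequentially. \<omega> \<in> space coin_space - B j"
    using B(1) by (intro borel_cantelli_AE1) (auto simp: coin.emeasure_finite less_top[symmetric])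
  then show ?thesis
  proof eventually_elim
    case (elim \<omega>)
    then show ?case by eventually_elim (use B(3) in blast)
  qed
qed

theorem theorem2:
  "almost_every_graph (\<lambda>G. \<forall>A \<subseteq> pos_nats.
     (\<Sum>\<^sub>\<infinity>n\<in>A. ennreal (1 / real n)) = \<infinity> \<longrightarrow> weakly_universal G A)"
proof -
  let ?P = "\<lambda>\<omega> (H :: nat graph). \<forall>\<^sub>F j in sequentially. \<forall>S \<subseteq> {2^j..<2^Suc j}.
    card S \<ge> (card (verts H))\<^sup>2 * (2^j div (Suc j)\<^sup>2) \<longrightarrow>
    contains_induced (induced_subgraph (random_graph \<omega>) S) H"
  \<comment> \<open>By countability one null set serves all \<open>H\<close>; since
    \<open>?P\<close> quantifies over all \<open>S\<close>, it also serves the uncountably many sets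
    \<open>A\<close>.\<close>
  have "AE \<omega> in coin_space. \<forall>H \<in> {H. finite_graph H}. ?P \<omega> H"
    unfolding AE_ball_countable[OF countable_finite_graphs]
    using AE_eventually_dense_subsets_contain[OF _ refl] by blast
  then show ?thesis
    unfolding almost_every_graph_def
  proof eventually_elim
    case (elim \<omega>)
    show ?case
    proof (intro allI impI)
      fix A assume A: "A \<subseteq> pos_nats" and inf: "(\<Sum>\<^sub>\<infinity>n\<in>A. ennreal (1 / real n)) = \<infinity>"
      show "weakly_universal (random_graph \<omega>) A"
        unfolding weakly_universal_def
      proof (intro allI impI, rule ccontr)
        fix H :: "nat graph"
        assume H: "finite_graph H" and no: "\<not> contains_induced (induced_subgraph (random_graph \<omega>) A) H"
        define k where "k = card (verts H)"
        have "?P \<omega> H" using elim H by blast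
        \<comment> \<open>A copy inside one block would be a copy inside \<open>A\<close>, so
          eventually every block of \<open>A\<close> has at most the threshold size. Division by
          \<open>2^j\<close> leaves a bound by a multiple of \<open>1 / (Suc j)^2\<close>.\<close>
        then have small: "\<forall>\<^sub>F j in sequentially.
            norm (real (card (A \<inter> {2^j..<2^Suc j})) / 2^j) \<le> (real k)\<^sup>2 * (1 / real (Suc j) ^ 2)"
        proof eventually_elim
          case (elim j)
          have "\<not> contains_induced (induced_subgraph (random_graph \<omega>) (A \<inter> {2^j..<2^Suc j})) H"
            using no contains_induced_mono by blast
          then have "card (A \<inter> {2^j..<2^Suc j}) \<le> k\<^sup>2 * (2^j div (Suc j)\<^sup>2)"
            using elim unfolding k_def by (meson Int_lower2 linear)
          then have "real (card (A \<inter> {2^j..<2^Suc j})) \<le> (real k)\<^sup>2 * real (2^j div (Suc j)\<^sup>2)"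
            by (metis of_nat_le_iff of_nat_mult of_nat_power)
          also have "real (2^j div (Suc j)\<^sup>2) \<le> real (2^j) / real ((Suc j)\<^sup>2)"
            using floor_divide_of_nat_eq[of "2^j" "(Suc j)\<^sup>2", where 'a = real] by linarith
          finally have "real (card (A \<inter> {2^j..<2^Suc j})) \<le> (real k)\<^sup>2 * (2^j / real (Suc j) ^ 2)"
            by (simp add: mult_left_mono)
          then show ?case by (simp add: field_simps)
        qed
        have "summable (\<lambda>j. 1 / real (Suc j) ^ 2)"
          using inverse_power_summable[of 2, where 'a = real]
          by (subst summable_Suc_iff) (simp add: inverse_eq_divide)
        then have "summable (\<lambda>j. real (card (A \<inter> {2^j..<2^Suc j})) / 2^j)"
          by (intro summable_comparison_test_ev[OF small] summable_mult)
        from infsum_reciprocals_finite[OF A this] inf show False by simp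
      qed
    qed
  qed
qed

end
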